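(* Let $\mathcal{D}$ be a dictionary in a real Hilbert space $\mathbb{H}$ and let $\alpha$ be a real number with $0\le\alpha\leq 1$. Let $(\mathcal{T}_m^r(f))_{m\ge 0}$ denote the approximants of the Power-Relaxed Greedy Algorithm with parameter $\alpha$. Then for every $f\in A_1(\mathcal{D})$ and every $m=1,2,\dots$, $$\Vert f-\mathcal{T}_m^r(f)\Vert^2\leq \frac{4}{m^{\alpha}}.$$
   Context: Let $\mathbb{H}$ be a real Hilbert space with inner product $\langle\cdot,\cdot\rangle$ and induced norm $\|\cdot\|$. A dictionary $\mathcal{D}$ in $\mathbb{H}$ is a subset of $\mathbb{H}$ such that $\|g\|=1$ for all $g\in\mathcal{D}$, $g\in\mathcal{D}$ implies $-g\in\mathcal{D}$, and the linear span of $\mathcal{D}$ is dense in $\mathbb{H}$. The class $A_1(\mathcal{D})$ is the closure in $\mathbb{H}$ of the set $$\Big\{ f\in\mathbb{H} : f=\sum_{k\in\Lambda}a_k g_k,\ g_k\in\mathcal{D},\ |\Lambda|<\infty,\ \sum_{k\in\Lambda}|a_k|\leq 1\Big\}.$$ For each $f\in\mathbb{H}$, let $g(f)\in\mathcal{D}$ be an element of $\mathcal{D}$ which maximizes $\langle f,g\rangle$ over $g\in\mathcal{D}$; it is a standing assumption that such a maximizer exists for every $f\in\mathbb{H}$ (one fixes any choice of maximizer). Power-Relaxed Greedy Algorithm with parameter $\alpha\ge 0$: given $f\in\mathbb{H}$, set $\mathcal{T}_0^r(f):=0$ and $\mathcal{R}_0^r(f):=f$; for $m=1$ set $\mathcal{T}_1^r(f):=\langle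 f,g(f)\rangle\, g(f)$ and $\mathcal{R}_1^r(f):=f-\mathcal{T}_1^r(f)$; for $m\geq 2$ set $$\mathcal{T}_m^r(f):=\Big(1-\frac{1}{m^\alpha}\Big)\mathcal{T}_{m-1}^r(f)+\frac{1}{m^\alpha}\,g(\mathcal{R}_{m-1}^r(f)),\qquad \mathcal{R}_m^r(f):=f-\mathcal{T}_m^r(f).$$ *)

theory Defs
  imports "HOL-Analysis.Analysis"
begin

text \<open>A real Hilbert space is a type of sort
  \<^class>\<open>real_inner\<close> and \<^class>\<open>complete_space\<close>.\<close>

definition dictionary :: "'a::{real_inner, complete_space} set \<Rightarrow> bool" where
  "dictionary D \<longleftrightarrow>
     (\<forall>g\<in>D. norm g = 1) \<and> (\<forall>g\<in>D. - g \<in> D) \<and> closure (span D) = UNIV"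

text \<open>Finite index sets are taken in the natural numbers, without loss of generality. The
  elements \<open>g k\<close> may repeat and the coefficients may have either sign.\<close>

definition A1_class :: "'a::{real_inner, complete_space} set \<Rightarrow> 'a set" where
  "A1_class D =
     closure {f. \<exists>(\<Lambda>::nat set) (a::nat \<Rightarrow> real) (g::nat \<Rightarrow> 'a).
       finite \<Lambda> \<and> (\<forall>k\<in>\<Lambda>. g k \<in> D) \<and>
       f = (\<Sum>k\<in>\<Lambda>. a k *\<^sub>R g k) \<and> (\<Sum>k\<in>\<Lambda>. \<bar>a k\<bar>) \<le> 1}"

text \<open>A fixed choice, for every \<open>f\<close>, of a maximizer of \<open>\<langle>f, h\<rangle>\<close> over \<open>h \<in> D\<close>.
  That such a choice exists expresses that the maximum is attained for every \<open>f\<close>.\<close>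

definition greedy_selector :: "'a::{real_inner, complete_space} set \<Rightarrow> ('a \<Rightarrow> 'a) \<Rightarrow> bool" where
  "greedy_selector D g \<longleftrightarrow> (\<forall>f. g f \<in> D \<and> (\<forall>h\<in>D. f \<bullet> h \<le> f \<bullet> g f))"

text \<open>The approximants of the Power-Relaxed Greedy Algorithm; the residual is
  \<open>f - prga \<alpha> g f m\<close>. In the last equation \<open>m = n + 2\<close>.\<close>

fun prga :: "real \<Rightarrow> ('a::{real_inner, complete_space} \<Rightarrow> 'a) \<Rightarrow> 'a \<Rightarrow> nat \<Rightarrow> 'a" where
  "prga \<alpha> g f 0 = 0"
| "prga \<alpha> g f (Suc 0) = (f \<bullet> g f) *\<^sub>R g f"
| "prga \<alpha> g f (Suc (Suc n)) =
     (1 - 1 / real (Suc (Suc n)) powr \<alpha>) *\<^sub>R prga \<alpha> g f (Suc n)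
     + (1 / real (Suc (Suc n)) powr \<alpha>) *\<^sub>R g (f - prga \<alpha> g f (Suc n))"

end

theory Submission
  imports Defs
begin

text \<open>Write \<open>R\<close> for a residual, \<open>h\<close> for the selected element and \<open>\<mu> = 1 / m powr \<alpha>\<close>.
  The next residual is \<open>(1 - \<mu>) R + \<mu> (f - h)\<close>. Since a linear functional is bounded on
  \<open>A\<^sub>1(D)\<close> by its maximum over \<open>D\<close>, the cross term \<open>\<langle>R, f - h\<rangle>\<close> is nonpositive, and
  \<open>\<parallel>f - h\<parallel> \<le> 2\<close>. Hence the squared residual norms satisfy
  \<open>r\<^sub>m \<le> (1 - \<mu>)\<^sup>2 r\<^sub>m\<^sub>-\<^sub>1 + 4 \<mu>\<^sup>2\<close>, and the bound propagates because
  \<open>m powr \<alpha> - 1 \<le> (m - 1) powr \<alpha>\<close> for \<open>\<alpha> \<le> 1\<close>.\<close>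

text \<open>The half-space where \<open>x \<bullet> y \<le> M\<close> is closed, so finite
  combinations suffice. Symmetry of \<open>D\<close> turns the one-sided bound into
  \<open>\<bar>x \<bullet> g k\<bar> \<le> M\<close>, which handles coefficients of either sign;
  \<open>0 \<le> M\<close> covers coefficient sums below 1.\<close>

lemma inner_A1_class_le:
  assumes D: "dictionary D" and M: "\<And>h. h \<in> D \<Longrightarrow> x \<bullet> h \<le> M"
    and "0 \<le> M" and f: "f \<in> A1_class D"
  shows "x \<bullet> f \<le> M"
proof -
  have "A1_class D \<subseteq> {y. x \<bullet> y \<le> M}"
    unfolding A1_class_def
  proof (rule closure_minimal[OF _ closed_halfspace_le], clarify)
    fix \<Lambda> :: "nat set" and a :: "nat \<Rightarrow> real" and g :: "nat \<Rightarrow> 'a"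
    assume g: "\<forall>k\<in>\<Lambda>. g k \<in> D" and a: "(\<Sum>k\<in>\<Lambda>. \<bar>a k\<bar>) \<le> 1"
    have "a k * (x \<bullet> g k) \<le> \<bar>a k\<bar> * M" if "k \<in> \<Lambda>" for k
    proof -
      have "- g k \<in> D"
        using D g that by (auto simp: dictionary_def)
      with M[of "g k"] M[of "- g k"] g that have "\<bar>x \<bullet> g k\<bar> \<le> M"
        by auto
      then show ?thesis
        by (metis abs_ge_self abs_ge_zero abs_mult mult_left_mono order_trans)
    qed
    then have "x \<bullet> (\<Sum>k\<in>\<Lambda>. a k *\<^sub>R g k) \<le> (\<Sum>k\<in>\<Lambda>. \<bar>a k\<bar> * M)"
      by (auto simp: inner_sum_right intro!: sum_mono)
    also have "\<dots> = (\<Sum>k\<in>\<Lambda>. \<bar>a k\<bar>) * M"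
      by (simp add: sum_distrib_right)
    also have "\<dots> \<le> M"
      using a \<open>0 \<le> M\<close> by (simp add: mult_left_le_one_le sum_nonneg)
    finally show "x \<bullet> (\<Sum>k\<in>\<Lambda>. a k *\<^sub>R g k) \<le> M" .
  qed
  with f show ?thesis by auto
qed

lemma inner_le_greedy:
  assumes D: "dictionary D" and g: "greedy_selector D g" and f: "f \<in> A1_class D"
  shows "x \<bullet> f \<le> x \<bullet> g x"
proof (rule inner_A1_class_le[OF D _ _ f])
  show "x \<bullet> h \<le> x \<bullet> g x" if "h \<in> D" for h
    using g that by (auto simp: greedy_selector_def)
  have "- g x \<in> D"
    using D g by (auto simp: dictionary_def greedy_selector_def)
  then have "x \<bullet> - g x \<le> x \<bullet> g x"
    using g unfolding greedy_selector_def by blast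
  then show "0 \<le> x \<bullet> g x" by simp
qed

lemma norm_greedy:
  assumes "dictionary D" and "greedy_selector D g"
  shows "norm (g x) = 1"
  using assms by (auto simp: dictionary_def greedy_selector_def)

text \<open>Testing \<open>f\<close> against itself and applying Cauchy-Schwarz gives
  \<open>f \<bullet> f \<le> f \<bullet> g f \<le> norm f\<close>; a nonzero \<open>norm f\<close>
  cancels.\<close>

lemma norm_A1_class_le_1:
  assumes "dictionary D" and "greedy_selector D g" and "f \<in> A1_class D"
  shows "norm f \<le> 1"
proof -
  have "norm f * norm f \<le> norm f * norm (g f)"
    using inner_le_greedy[OF assms, of f] norm_cauchy_schwarz[of f "g f"]
    by (simp add: dot_square_norm power2_eq_square)
  then show ?thesis
    by (cases "f = 0") (use assms in \<open>auto simp: norm_greedy\<close>)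
qed

lemma relaxed_step_norm_le:
  fixes f t h :: "'a::real_inner"
  assumes "0 \<le> \<mu>" "\<mu> \<le> 1" and opt: "(f - t) \<bullet> f \<le> (f - t) \<bullet> h"
    and "norm f \<le> 1" "norm h \<le> 1"
  shows "(norm (f - ((1 - \<mu>) *\<^sub>R t + \<mu> *\<^sub>R h)))\<^sup>2
           \<le> (1 - \<mu>)\<^sup>2 * (norm (f - t))\<^sup>2 + 4 * \<mu>\<^sup>2"
proof -
  let ?u = "f - t" and ?v = "f - h"
  have eq: "f - ((1 - \<mu>) *\<^sub>R t + \<mu> *\<^sub>R h) = (1 - \<mu>) *\<^sub>R ?u + \<mu> *\<^sub>R ?v"
    by (simp add: algebra_simps)
  have "(norm ((1 - \<mu>) *\<^sub>R ?u + \<mu> *\<^sub>R ?v))\<^sup>2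
      = (1 - \<mu>)\<^sup>2 * (norm ?u)\<^sup>2 + \<mu>\<^sup>2 * (norm ?v)\<^sup>2 + 2 * ((1 - \<mu>) * \<mu> * (?u \<bullet> ?v))"
    unfolding power2_norm_eq_inner inner_add_left inner_add_right
      inner_scaleR_left inner_scaleR_right inner_commute[of ?v ?u]
    by (simp add: power2_eq_square algebra_simps)
  \<comment> \<open>\<open>opt\<close> says exactly that
    \<open>?u \<bullet> ?v \<le> 0\<close>.\<close>
  moreover have "(1 - \<mu>) * \<mu> * (?u \<bullet> ?v) \<le> 0"
    using assms by (intro mult_nonneg_nonpos) (auto simp: inner_diff_right)
  moreover have "norm ?v \<le> 2"
    using norm_triangle_ineq4[of f h] assms by linarith
  then have "(norm ?v)\<^sup>2 \<le> 2\<^sup>2"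
    by (intro power_mono) auto
  then have "\<mu>\<^sup>2 * (norm ?v)\<^sup>2 \<le> \<mu>\<^sup>2 * 4"
    by (intro mult_left_mono) auto
  ultimately show ?thesis
    unfolding eq by linarith
qed

text \<open>One factor \<open>x + 1\<close> is split off the power; the remaining exponent
  \<open>\<alpha> - 1\<close> is nonpositive, so that power decreases in its base.\<close>

lemma powr_add_one_le:
  fixes x \<alpha> :: real
  assumes "0 < x" "0 \<le> \<alpha>" "\<alpha> \<le> 1"
  shows "(x + 1) powr \<alpha> \<le> x powr \<alpha> + 1"
proof -
  have "(x + 1) powr \<alpha> = x * (x + 1) powr (\<alpha> - 1) + (x + 1) powr (\<alpha> - 1)"
    using assms powr_mult_base[of "x + 1" "\<alpha> - 1"] by (simp add: algebra_simps)
  also have "\<dots> \<le> x * x powr (\<alpha> - 1) + 1"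
  proof (rule add_mono)
    show "x * (x + 1) powr (\<alpha> - 1) \<le> x * x powr (\<alpha> - 1)"
      using assms by (intro mult_left_mono powr_mono2') auto
    show "(x + 1) powr (\<alpha> - 1) \<le> 1"
      using assms powr_mono[of "\<alpha> - 1" 0 "x + 1"] by simp
  qed
  also have "x * x powr (\<alpha> - 1) = x powr \<alpha>"
    using assms by (simp add: powr_diff)
  finally show ?thesis .
qed

text \<open>The induction step, with \<open>p\<close> and \<open>q\<close> the powers of consecutive
  indices. After division by 4 the claim is
  \<open>(1 - 1 / q)\<^sup>2 / p \<le> (1 - 1 / q) * (1 / q)\<close>, which reduces to
  \<open>q - 1 \<le> p\<close>.\<close>

lemma relaxed_recursion_le:
  fixes p q :: real
  assumes "0 < p" "1 \<le> q" "q \<le> p + 1"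
  shows "(1 - 1 / q)\<^sup>2 * (4 / p) + 4 * (1 / q)\<^sup>2 \<le> 4 / q"
proof -
  have "(q - 1) / q / p \<le> 1 / q"
    using assms by (simp add: divide_right_mono pos_divide_le_eq)
  then have "(1 - 1 / q) / p \<le> 1 / q"
    using assms by (simp add: diff_divide_distrib)
  then have "(1 - 1 / q) * ((1 - 1 / q) / p) \<le> (1 - 1 / q) * (1 / q)"
    using assms by (intro mult_left_mono) auto
  moreover have "(1 - 1 / q)\<^sup>2 * (4 / p) = 4 * ((1 - 1 / q) * ((1 - 1 / q) / p))"
    by (simp add: power2_eq_square)
  moreover have "(1 - 1 / q) * (1 / q) = 1 / q - (1 / q)\<^sup>2"
    by (simp add: power2_eq_square diff_divide_distrib)
  ultimately show ?thesis
    by linarith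
qed

theorem theorem3p2:
  fixes D :: "'a::{real_inner, complete_space} set"
    and g :: "'a \<Rightarrow> 'a"
    and \<alpha> :: real and f :: 'a and m :: nat
  assumes "dictionary D"
    and "greedy_selector D g"
    and "0 \<le> \<alpha>" and "\<alpha> \<le> 1"
    and "f \<in> A1_class D"
    and "m \<ge> 1"
  shows "(norm (f - prga \<alpha> g f m))\<^sup>2 \<le> 4 / real m powr \<alpha>"
  using \<open>m \<ge> 1\<close>
proof (induction m rule: nat_induct_at_least)
  case base
  \<comment> \<open>The first approximant is a projection, not a relaxed step. The triangle
    inequality bounds its residual by 1 + 1, whose square is the constant 4.\<close>
  have "norm f \<le> 1" "norm (g f) = 1"
    using assms norm_A1_class_le_1 norm_greedy by blast+
  then have "\<bar>f \<bullet> g f\<bar> \<le> 1"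
    using Cauchy_Schwarz_ineq2[of f "g f"] by simp
  then have "norm (f - (f \<bullet> g f) *\<^sub>R g f) \<le> 2"
    using norm_triangle_ineq4[of f "(f \<bullet> g f) *\<^sub>R g f"] \<open>norm f \<le> 1\<close> \<open>norm (g f) = 1\<close>
    by simp
  then have "(norm (f - (f \<bullet> g f) *\<^sub>R g f))\<^sup>2 \<le> 2\<^sup>2"
    by (intro power_mono) auto
  then show ?case by simp
next
  case (Suc m)
  define q where "q = real (Suc m) powr \<alpha>"
  let ?t = "prga \<alpha> g f m"
  let ?h = "g (f - ?t)"
  have q: "1 \<le> q" "q \<le> real m powr \<alpha> + 1"
    unfolding q_def
    using Suc.hyps assms powr_add_one_le[of "real m" \<alpha>]
    by (auto simp: ge_one_powr_ge_zero add.commute)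
  \<comment> \<open>The relaxed equation of \<open>prga\<close> applies only from index 2
    on.\<close>
  obtain n where "m = Suc n"
    using Suc.hyps by (cases m) auto
  then have "prga \<alpha> g f (Suc m) = (1 - 1 / q) *\<^sub>R ?t + (1 / q) *\<^sub>R ?h"
    by (simp add: q_def)
  then have "(norm (f - prga \<alpha> g f (Suc m)))\<^sup>2
      \<le> (1 - 1 / q)\<^sup>2 * (norm (f - ?t))\<^sup>2 + 4 * (1 / q)\<^sup>2"
    using relaxed_step_norm_le[of "1 / q" f ?t ?h] q inner_le_greedy assms
      norm_A1_class_le_1 norm_greedy[of D g "f - ?t"]
    by fastforce
  also have "\<dots> \<le> (1 - 1 / q)\<^sup>2 * (4 / real m powr \<alpha>) + 4 * (1 / q)\<^sup>2"
    by (intro add_right_mono mult_left_mono Suc.IH) auto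
  also have "\<dots> \<le> 4 / q"
    using Suc.hyps q by (intro relaxed_recursion_le) auto
  finally show ?case by (simp add: q_def)
qed

end
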